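(* For every integer $r > 1$, $m(r) \geq 2^r + 2$.
   Context: For a positive integer $n$, the unitary Cayley graph $X_n = \mathrm{Cay}(\mathbb{Z}_n, U_n)$ has vertex set $\mathbb{Z}_n$, and $x,y$ are adjacent iff $x - y \in U_n$, the group of units of $\mathbb{Z}_n$. An induced cycle of length $k \geq 3$ is a sequence of $k$ distinct vertices $v_0, \dots, v_{k-1}$ such that $v_i$ and $v_j$ are adjacent if and only if $i - j \equiv \pm 1 \pmod k$. $M(n)$ denotes the length of the longest induced cycle in $X_n$, and $m(r) = \max_n M(n)$ over all $n$ with exactly $r$ distinct prime divisors. *)

theory Defs
  imports "HOL-Number_Theory.Number_Theory" "HOL-Library.Ramsey"
begin

text \<open>The vertex set of the unitary Cayley graph of \<open>\<int>/n\<int>\<close> is the carrier of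
  \<open>residue_ring n\<close>, i.e. the set of representatives \<open>{0..n-1}\<close>. For \<open>n = 1\<close> the library's
  ring has no units, so that graph is a single vertex without a loop.\<close>

definition cayley_verts :: "nat \<Rightarrow> int set" where
  "cayley_verts n = carrier (residue_ring (int n))"

definition cayley_adj :: "nat \<Rightarrow> int \<Rightarrow> int \<Rightarrow> bool" where
  "cayley_adj n x y \<longleftrightarrow> x \<ominus>\<^bsub>residue_ring (int n)\<^esub> y \<in> Units (residue_ring (int n))"

definition induced_cycle :: "'a set \<Rightarrow> ('a \<Rightarrow> 'a \<Rightarrow> bool) \<Rightarrow> nat \<Rightarrow> (nat \<Rightarrow> 'a) \<Rightarrow> bool" where
  "induced_cycle V adj k v \<longleftrightarrow>
     k \<ge> 3 \<and> v ` {..<k} \<subseteq> V \<and> inj_on v {..<k} \<and>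
     (\<forall>i<k. \<forall>j<k. adj (v i) (v j) \<longleftrightarrow>
        [int i - int j = 1] (mod int k) \<or> [int i - int j = - 1] (mod int k))"

text \<open>\<open>Sup\<close> on \<^typ>\<open>nat\<close> is the maximum of a nonempty finite set and \<open>0\<close> for the empty set.
  The lengths below are bounded by \<open>n\<close>, and the set is empty only if the graph has no cycle,
  which for \<open>n\<close> with at least two prime divisors does not happen.\<close>

definition longest_induced_cycle :: "nat \<Rightarrow> nat" where
  "longest_induced_cycle n =
     Sup {k. \<exists>v. induced_cycle (cayley_verts n) (cayley_adj n) k v}"

definition max_longest_induced_cycle :: "nat \<Rightarrow> nat" where
  "max_longest_induced_cycle r =
     Max {longest_induced_cycle n | n. n > 0 \<and> card (prime_factors n) = r}"

lemma cayley_adj_coprime: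
  assumes "n > 0" "x \<in> cayley_verts n" "y \<in> cayley_verts n" "x \<noteq> y"
  shows "cayley_adj n x y \<longleftrightarrow> coprime (x - y) (int n)"
proof -
  have n: "int n > 1"
    using assms by (auto simp: cayley_verts_def residue_ring_def)
  interpret residues "int n" "residue_ring (int n)"
    using n by unfold_locales
  have mod: "x \<ominus>\<^bsub>residue_ring (int n)\<^esub> y = (x - y) mod int n"
    by (simp add: a_minus_def res_neg_eq res_add_eq mod_simps)
  have "\<bar>x - y\<bar> < int n"
    using assms by (auto simp: cayley_verts_def residue_ring_def)
  then have "(x - y) mod int n \<noteq> 0"
    using assms zdvd_not_zless[of "\<bar>x - y\<bar>" "int n"] by (auto simp: mod_eq_0_iff_dvd)
  then have "(x - y) mod int n > 0"
    using n pos_mod_sign[of "int n" "x - y"] by linarith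
  then show ?thesis
    using n by (auto simp: cayley_adj_def mod res_units_eq)
qed

text \<open>The maximum in \<open>max_longest_induced_cycle\<close> is attained: with Ramsey's theorem, an induced
  cycle that is long compared to \<open>r\<close> has edges \<open>a\<^sub>i b\<^sub>i\<close> for \<open>i \<in> {1, 2, 3}\<close> such that
  \<open>a\<^sub>i - b\<^sub>j\<close> for all \<open>i < j\<close> is divisible by the same prime divisor of \<open>n\<close>, which then also
  divides \<open>a\<^sub>2 - b\<^sub>2\<close>.\<close>

lemma induced_cycle_length_bounded:
  "\<exists>N. \<forall>n k v. n > 0 \<longrightarrow> card (prime_factors n) = r \<longrightarrow>
     induced_cycle (cayley_verts n) (cayley_adj n) k v \<longrightarrow> k < N"
proof -
  obtain N where N: "partn_lst {..<N::nat} (replicate r 3) 2"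
    using ramsey_full by blast
  have "k < 3 * N + 3" if n: "n > 0" and r: "card (prime_factors n) = r"
    and v: "induced_cycle (cayley_verts n) (cayley_adj n) k v" for n k v
  proof (rule ccontr)
    assume "\<not> k < 3 * N + 3"
    then have k: "k \<ge> 3 * N + 3" by simp
    define a b where "a = (\<lambda>i. v (3 * i))" and "b = (\<lambda>i. v (3 * i + 1))"
    obtain h where h: "bij_betw h (prime_factors n) {..<r}"
      using r ex_bij_betw_finite_nat[of "prime_factors n"] by (auto simp: atLeast0LessThan)
    have adj: "coprime (v i - v j) (int n) \<longleftrightarrow>
        [int i - int j = 1] (mod int k) \<or> [int i - int j = - 1] (mod int k)"
      if "i < k" "j < k" "i \<noteq> j" for i j
    proof -
      have "v i \<noteq> v j"
        using v that by (auto simp: induced_cycle_def inj_on_def)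
      moreover have "v i \<in> cayley_verts n" "v j \<in> cayley_verts n"
        using v that by (auto simp: induced_cycle_def)
      moreover have "cayley_adj n (v i) (v j) \<longleftrightarrow>
          [int i - int j = 1] (mod int k) \<or> [int i - int j = - 1] (mod int k)"
        using v that by (simp add: induced_cycle_def)
      ultimately show ?thesis
        using cayley_adj_coprime[OF n] by simp
    qed
    have coprime: "coprime (a i - b i) (int n)" if "i < N" for i
      using adj[of "3 * i" "3 * i + 1"] that k by (auto simp: a_def b_def)
    have "\<exists>p\<in>prime_factors n. int p dvd a i - b j" if "i < j" "j < N" for i j
    proof -
      have "\<not> int k dvd 3 * int j + 2 - 3 * int i" "\<not> int k dvd 3 * int j - 3 * int i"
        using that k by (auto dest!: zdvd_imp_le)
      then have "\<not> int k dvd int (3 * i) - int (3 * j + 1) - 1"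
        and "\<not> int k dvd int (3 * i) - int (3 * j + 1) - (- 1)"
        by (subst dvd_minus_iff[symmetric], simp add: algebra_simps)+
      then have "\<not> coprime (a i - b j) (int n)"
        using adj[of "3 * i" "3 * j + 1"] that k
        by (auto simp: a_def b_def cong_iff_dvd_diff)
      then have "gcd (a i - b j) (int n) \<noteq> 1"
        by (simp add: coprime_iff_gcd_eq_1)
      then have "nat (gcd (a i - b j) (int n)) \<noteq> 1"
        by simp
      then obtain p where p: "prime p" "p dvd nat (gcd (a i - b j) (int n))"
        by (metis prime_factor_nat)
      then have "int p dvd gcd (a i - b j) (int n)"
        by (metis gcd_ge_0_int int_dvd_int_iff int_nat_eq)
      then have "int p dvd a i - b j" "p dvd n"
        by simp_all
      then show ?thesis
        using p n by (auto simp: prime_factors_dvd intro!: bexI[of _ p])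
    qed
    then obtain p where p: "\<And>i j. i < j \<Longrightarrow> j < N \<Longrightarrow>
        p i j \<in> prime_factors n \<and> int (p i j) dvd a i - b j"
      by metis
    define f where "f = (\<lambda>e. h (p (Min e) (Max e)))"
    have f_eq: "f {i, j} = h (p i j)" if "i < j" for i j
      using that by (simp add: f_def min_def max_def)
    have "f \<in> [{..<N}]\<^bsup>2\<^esup> \<rightarrow> {..<r}"
    proof
      fix e assume "e \<in> [{..<N}]\<^bsup>2\<^esup>"
      then obtain i j where e: "e = {i, j}" "i < N" "j < N" "i \<noteq> j"
        by (blast elim: nsets2_E)
      then obtain i j where "e = {i, j}" "i < j" "j < N"
        by (metis insert_commute linorder_neqE_nat)
      then show "f e \<in> {..<r}"
        using f_eq p h by (metis bij_betwE)
    qed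
    then obtain c H where "c < length (replicate r (3::nat))"
        "H \<in> [{..<N}]\<^bsup>(replicate r 3 ! c)\<^esup>" "f ` [H]\<^bsup>2\<^esup> \<subseteq> {c}"
      using partn_lstE[OF N, of f r] by auto
    then have H: "H \<subseteq> {..<N}" "finite H" "card H = 3" "f ` [H]\<^bsup>2\<^esup> \<subseteq> {c}"
      by (auto simp: nsets_def)
    define xs where "xs = sorted_list_of_set H"
    have "length xs = 3" "sorted_wrt (<) xs" "set xs = H"
      using H by (auto simp: xs_def)
    then obtain x y z where xyz: "x < y" "y < z" "H = {x, y, z}"
      by (auto simp: numeral_3_eq_3 length_Suc_conv)
    have c: "h (p i j) = c" if "i \<in> H" "j \<in> H" "i < j" for i j
    proof -
      have "{i, j} \<in> [H]\<^bsup>2\<^esup>"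
        using that by (auto simp: nsets_def)
      then have "f {i, j} \<in> {c}"
        using H(4) by blast
      then show ?thesis
        using f_eq[OF that(3)] by simp
    qed
    have lt: "x < N" "y < N" "z < N"
      using H xyz by auto
    have "h (p x y) = c" "h (p x z) = c" "h (p y z) = c"
      using c xyz by auto
    then have eq: "p x z = p x y" "p y z = p x y"
      using p[of x y] p[of x z] p[of y z] xyz lt h
      by (auto simp: bij_betw_def inj_on_def)
    have "int (p x y) dvd a x - b y" "int (p x y) dvd a x - b z" "int (p x y) dvd a y - b z"
      using p[of x y] p[of x z] p[of y z] xyz lt eq by auto
    then have "int (p x y) dvd (a x - b y) - (a x - b z) + (a y - b z)"
      by (simp only: dvd_add dvd_diff)
    then have "int (p x y) dvd a y - b y"
      by simp
    moreover have "int (p x y) dvd int n" "prime (p x y)"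
      using p[of x y] xyz lt by (auto simp: prime_factors_dvd)
    ultimately have "is_unit (int (p x y))"
      using coprime[OF lt(2)] coprime_common_divisor by blast
    then show False
      using \<open>prime (p x y)\<close> by simp
  qed
  then show ?thesis by blast
qed

lemma finite_longest_induced_cycle:
  "finite {longest_induced_cycle n | n. n > 0 \<and> card (prime_factors n) = r}"
proof -
  obtain N where N: "\<And>n k v. n > 0 \<Longrightarrow> card (prime_factors n) = r \<Longrightarrow>
      induced_cycle (cayley_verts n) (cayley_adj n) k v \<Longrightarrow> k < N"
    using induced_cycle_length_bounded by blast
  have "longest_induced_cycle n \<le> N" if "n > 0" "card (prime_factors n) = r" for n
  proof (cases "{k. \<exists>v. induced_cycle (cayley_verts n) (cayley_adj n) k v} = {}")
    case True
    then show ?thesis by (simp add: longest_induced_cycle_def Sup_nat_def)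
  next
    case False
    moreover have "k \<le> N" if "k \<in> {k. \<exists>v. induced_cycle (cayley_verts n) (cayley_adj n) k v}" for k
      using that N[OF \<open>n > 0\<close> \<open>card (prime_factors n) = r\<close>] less_imp_le by blast
    ultimately show ?thesis
      unfolding longest_induced_cycle_def by (rule cSup_least)
  qed
  then show ?thesis
    by (auto intro: finite_subset[OF _ finite_atMost[of N]])
qed

end

theory Submission
  imports Defs
begin

text \<open>By the Chinese remainder theorem, for large distinct primes \<open>p\<^sub>0, \<dots>, p\<^sub>r\<^sub>-\<^sub>1\<close> an induced cycle
  of length \<open>k\<close> modulo their product amounts to \<open>r\<close> proper colourings of the \<open>k\<close>-cycle such that
  any two nonadjacent vertices receive the same colour in at least one of them.

  For \<open>k = 2\<^sup>r + 2\<close> regard the cycle as the path \<open>0, \<dots>, 2\<^sup>r\<close> together with one extra vertex \<open>w\<close>.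
  Colouring \<open>0\<close> is the parity, which settles all pairs at even distance. For \<open>1 \<le> t < r\<close> the path
  is cut into blocks of length \<open>2\<^sup>t\<^sup>+\<^sup>1\<close>, and in colouring \<open>t\<close> the even vertices of one half of a block
  agree with the odd vertices of its other half. Bisecting repeatedly, an even and an odd vertex
  at distance at least \<open>3\<close> are separated by the midpoint of a common block. The midpoints themselves
  form a colour class of their own together with \<open>w\<close>; every even vertex strictly inside the
  path is a midpoint at some level.\<close>

section \<open>Colourings of the path by half-blocks\<close>

definition half_block_colour :: "nat \<Rightarrow> nat \<Rightarrow> nat" where
  "half_block_colour D x =
     (if x mod (2 * D) = D then 0
      else if even x \<longleftrightarrow> x mod (2 * D) < D then x div (2 * D) + 1
      else x div (2 * D) + 2)"

text \<open>Inside a half-block the parity rule alternates two colours, and the midpoint alone in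
  its block has colour \<open>0\<close>. A step from block \<open>q\<close> to the next leads from
  an odd vertex, coloured \<open>0\<close> or \<open>q + 1\<close>, to an even one coloured
  \<open>q + 2\<close>.\<close>

lemma half_block_colour_Suc:
  assumes "D > 0"
  shows "half_block_colour D (Suc x) \<noteq> half_block_colour D x"
proof -
  have parity: "even x \<longleftrightarrow> even (x mod (2 * D))"
    by (simp add: dvd_mod_iff)
  show ?thesis
  proof (cases "Suc (x mod (2 * D)) = 2 * D")
    case True
    then have "odd (Suc (Suc (x mod (2 * D))))"
      by (metis even_Suc even_mult_iff even_numeral)
    then show ?thesis
      using True parity assms
      by (auto simp: half_block_colour_def mod_Suc div_Suc)
  next
    case False
    then show ?thesis
      using assms by (auto simp: half_block_colour_def mod_Suc div_Suc)
  qed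
qed

lemma half_block_colour_le: "half_block_colour D x \<le> x + 2"
  by (simp add: half_block_colour_def le_SucI)

text \<open>Consecutive blocks overlap in one colour so that \<open>a = 2 * D\<close> is covered:
  this endpoint opens block \<open>q + 1\<close> and gets \<open>(q + 1) + 1\<close>, exactly what
  an even vertex in the upper half of block \<open>q\<close> gets.\<close>

lemma half_block_colour_block:
  assumes "a \<le> 2 * D" "a \<noteq> D" "D > 0"
  shows "half_block_colour D (2 * D * q + a) = (if even a \<longleftrightarrow> a < D then q + 1 else q + 2)"
proof (cases "a = 2 * D")
  case True
  then have "2 * D * q + a = 2 * D * (q + 1)"
    by simp
  then have "(2 * D * q + a) mod (2 * D) = 0" "(2 * D * q + a) div (2 * D) = q + 1"
    using assms(3) by (simp_all del: mult_Suc_right add_mult_distrib2)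
  then show ?thesis
    using True assms by (simp add: half_block_colour_def)
next
  case False
  then have "(2 * D * q + a) mod (2 * D) = a" "(2 * D * q + a) div (2 * D) = q"
    using assms by simp_all
  then show ?thesis
    using assms by (simp add: half_block_colour_def)
qed

lemma half_block_colours_agree:
  assumes "even x" "odd y" "x + 3 \<le> y \<or> y + 3 \<le> x"
    and "2 ^ Suc n * q \<le> x" "x \<le> 2 ^ Suc n * (q + 1)"
    and "2 ^ Suc n * q \<le> y" "y \<le> 2 ^ Suc n * (q + 1)"
  shows "\<exists>t\<in>{1..n}. half_block_colour (2 ^ t) x = half_block_colour (2 ^ t) y"
  using assms(4-)
proof (induction n arbitrary: q)
  case 0
  then show ?case
    using assms(3) by auto
next
  case (Suc n)
  define D :: nat where "D = 2 ^ Suc n"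
  have D: "D > 0" "even D"
    by (simp_all add: D_def)
  obtain a where a: "x = 2 * D * q + a"
    using Suc.prems(1) le_Suc_ex unfolding D_def by (metis power_Suc)
  obtain b where b: "y = 2 * D * q + b"
    using Suc.prems(3) le_Suc_ex unfolding D_def by (metis power_Suc)
  have bounds: "a \<le> 2 * D" "b \<le> 2 * D"
    using Suc.prems a b by (simp_all add: D_def algebra_simps)
  have parity: "even a" "odd b"
    using assms a b by auto
  \<comment> \<open>The halves of block \<open>q\<close> are the blocks \<open>2 * q\<close> and
    \<open>2 * q + 1\<close> one level down. They are closed, so a pair containing the midpoint
    falls under the first two cases and strict separation remains for the others.\<close>
  consider "a \<le> D" "b \<le> D" | "a \<ge> D" "b \<ge> D" | "a < D" "b > D" | "a > D" "b < D"
    by linarith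
  then show ?case
  proof cases
    case 1
    then have "\<exists>t\<in>{1..n}. half_block_colour (2 ^ t) x = half_block_colour (2 ^ t) y"
      using a b by (intro Suc.IH[of "2 * q"]) (simp_all add: D_def[symmetric] algebra_simps del: power_Suc)
    then show ?thesis by auto
  next
    case 2
    then have "\<exists>t\<in>{1..n}. half_block_colour (2 ^ t) x = half_block_colour (2 ^ t) y"
      using a b bounds
      by (intro Suc.IH[of "2 * q + 1"]) (simp_all add: D_def[symmetric] algebra_simps del: power_Suc)
    then show ?thesis by auto
  next
    case 3
    then have "half_block_colour D x = half_block_colour D y"
      using half_block_colour_block[of a D q] half_block_colour_block[of b D q] a b bounds parity D
      by simp
    then show ?thesis
      unfolding D_def by (intro bexI[of _ "Suc n"]) auto
  next
    case 4
    then have "half_block_colour D x = half_block_colour D y"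
      using half_block_colour_block[of a D q] half_block_colour_block[of b D q] a b bounds parity D
      by simp
    then show ?thesis
      unfolding D_def by (intro bexI[of _ "Suc n"]) auto
  qed
qed

section \<open>Colourings of the whole cycle\<close>

text \<open>The vertex \<open>2 ^ r + 1\<close> is \<open>w\<close>. Level \<open>0\<close> needs no
  exception for it when \<open>r > 0\<close>: it is odd and its neighbours \<open>0\<close> and
  \<open>2 ^ r\<close> are even.\<close>

definition cycle_colour :: "nat \<Rightarrow> nat \<Rightarrow> nat \<Rightarrow> nat" where
  "cycle_colour r t x =
     (if t = 0 then x mod 2
      else if x = 2 ^ r + 1 then 0
      else half_block_colour (2 ^ t) x)"

lemma cycle_colour_le: "cycle_colour r t x \<le> x + 2"
  using half_block_colour_le[of "2 ^ t" x] by (simp add: cycle_colour_def le_SucI)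

lemma half_block_colour_multiple:
  assumes "2 * D dvd x" "D > 0"
  shows "half_block_colour D x \<noteq> 0"
  using assms by (auto simp: half_block_colour_def)

text \<open>The level is the exponent \<open>t\<close> of 2 in \<open>x\<close>, since an odd
  multiple of \<open>2 ^ t\<close> is congruent to \<open>2 ^ t\<close> modulo
  \<open>2 * 2 ^ t\<close>.\<close>

lemma half_block_colour_midpoint:
  assumes "even x" "0 < x" "x < 2 ^ r"
  shows "\<exists>t\<in>{1..<r}. half_block_colour (2 ^ t) x = 0"
proof -
  obtain y where y: "x = 2 ^ multiplicity 2 x * y" "odd y"
    using assms(2) multiplicity_decompose'[of x 2] by auto
  define t where "t = multiplicity 2 x"
  have "t \<ge> 1"
    using y assms(1) unfolding t_def by (cases "multiplicity 2 x") auto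
  have "(2::nat) ^ t \<le> x"
    using y assms(2) unfolding t_def by (metis dvd_imp_le dvd_triv_left)
  then have "t < r"
    using assms(3) by (metis le_less_trans nat_power_less_imp_less zero_less_numeral)
  obtain z where "y = 2 * z + 1"
    using y(2) oddE by blast
  then have "x = 2 ^ t + 2 * 2 ^ t * z"
    using y(1) by (simp add: t_def algebra_simps)
  then have "x mod (2 * 2 ^ t) = 2 ^ t"
    by simp
  then show ?thesis
    using \<open>t \<ge> 1\<close> \<open>t < r\<close> by (auto simp: half_block_colour_def intro!: bexI[of _ t])
qed

lemma cycle_colour_proper:
  assumes "i < j" "j < 2 ^ r + 2" "t < r" and "j = Suc i \<or> i = 0 \<and> j = 2 ^ r + 1"
  shows "cycle_colour r t i \<noteq> cycle_colour r t j"
proof (cases "t = 0")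
  case True
  then show ?thesis
    using assms by (auto simp: cycle_colour_def mod_Suc split: if_splits)
next
  case False
  have dvd: "2 * 2 ^ t dvd (2::nat) ^ r"
    using assms(3) by (metis Suc_leI le_imp_power_dvd power_Suc)
  show ?thesis
  proof (cases "j = 2 ^ r + 1")
    case True
    \<comment> \<open>Here \<open>i\<close> is \<open>0\<close> or \<open>2 ^ r\<close>, a block
      boundary at every level below \<open>r\<close> and hence never a midpoint.\<close>
    then have "2 * 2 ^ t dvd i"
      using assms dvd by auto
    then show ?thesis
      using True False assms(1) half_block_colour_multiple[of "2 ^ t" i]
      by (simp add: cycle_colour_def)
  next
    case False': False
    then show ?thesis
      using False assms half_block_colour_Suc[of "2 ^ t" i] by (simp add: cycle_colour_def)
  qed
qed

lemma cycle_colours_agree: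
  assumes "r > 1" "i < j" "j < 2 ^ r + 2" "j \<noteq> Suc i" "\<not> (i = 0 \<and> j = 2 ^ r + 1)"
  shows "\<exists>t<r. cycle_colour r t i = cycle_colour r t j"
proof (cases "even i \<longleftrightarrow> even j")
  case True
  then have "cycle_colour r 0 i = cycle_colour r 0 j"
    by (simp add: cycle_colour_def mod2_eq_if)
  then show ?thesis
    using assms(1) by (intro exI[of _ 0]) auto
next
  case parity: False
  show ?thesis
  proof (cases "j = 2 ^ r + 1")
    case True
    then have "odd j" using assms(1) by simp
    then have "even i" using parity by simp
    moreover have "i \<noteq> 2 ^ r" "i > 0" "i < 2 ^ r + 1"
      using True assms by auto
    ultimately obtain t where "t \<in> {1..<r}" "half_block_colour (2 ^ t) i = 0"
      using half_block_colour_midpoint[of i r] by auto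
    then show ?thesis
      using True assms(2) by (intro exI[of _ t]) (auto simp: cycle_colour_def)
  next
    case False
    \<comment> \<open>Nonadjacency rules out distance 1, opposite parity rules out distance
      2.\<close>
    have "i + 3 \<le> j"
    proof -
      have "j \<noteq> i + 2" using parity by auto
      then show ?thesis using assms by linarith
    qed
    moreover have "j \<le> 2 ^ r"
      using False assms(3) by linarith
    moreover obtain n where n: "r = Suc n"
      using assms(1) by (cases r) auto
    ultimately have far: "i + 3 \<le> j" "i \<le> 2 ^ Suc n" "j \<le> 2 ^ Suc n"
      by simp_all
    \<comment> \<open>The whole path is the single block \<open>q = 0\<close> of length
      \<open>2 ^ Suc n\<close>.\<close>
    have "\<exists>t\<in>{1..n}. half_block_colour (2 ^ t) i = half_block_colour (2 ^ t) j"
    proof (cases "even i")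
      case True
      then show ?thesis
        using parity far by (intro half_block_colours_agree[where q = 0]) simp_all
    next
      case False
      then have "\<exists>t\<in>{1..n}. half_block_colour (2 ^ t) j = half_block_colour (2 ^ t) i"
        using parity far by (intro half_block_colours_agree[where q = 0]) simp_all
      then show ?thesis
        by metis
    qed
    then obtain t where "t \<in> {1..n}" "half_block_colour (2 ^ t) i = half_block_colour (2 ^ t) j"
      by blast
    then show ?thesis
      using n False assms(2) \<open>j \<le> 2 ^ r\<close> by (intro exI[of _ t]) (auto simp: cycle_colour_def)
  qed
qed

section \<open>From colourings to induced cycles in the Cayley graph\<close>

text \<open>The congruences say that \<open>k\<close> divides \<open>j + 1 - i\<close>, which lies
  between \<open>2\<close> and \<open>k\<close>, or \<open>j - 1 - i\<close>, which lies between
  \<open>0\<close> and \<open>k - 2\<close>.\<close>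

lemma cong_neighbour_iff:
  assumes "i < j" "j < k"
  shows "[int i - int j = 1] (mod int k) \<or> [int i - int j = - 1] (mod int k)
    \<longleftrightarrow> j = Suc i \<or> i = 0 \<and> j = k - 1"
proof -
  have "[int i - int j = 1] (mod int k) \<longleftrightarrow> int k dvd int (j + 1 - i)"
    using assms by (simp add: cong_iff_dvd_diff of_nat_diff dvd_diff_commute algebra_simps)
  also have "\<dots> \<longleftrightarrow> k dvd j + 1 - i"
    by (rule int_dvd_int_iff)
  also have "\<dots> \<longleftrightarrow> i = 0 \<and> j = k - 1"
    using assms dvd_imp_le[of k "j + 1 - i"] by auto
  finally have 1: "[int i - int j = 1] (mod int k) \<longleftrightarrow> i = 0 \<and> j = k - 1" .
  have "[int i - int j = - 1] (mod int k) \<longleftrightarrow> int k dvd int (j - 1 - i)"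
    using assms by (simp add: cong_iff_dvd_diff of_nat_diff dvd_diff_commute algebra_simps)
  also have "\<dots> \<longleftrightarrow> k dvd j - 1 - i"
    by (rule int_dvd_int_iff)
  also have "\<dots> \<longleftrightarrow> j = Suc i"
    using assms dvd_imp_le[of k "j - 1 - i"] by (cases "Suc i < j") auto
  finally show ?thesis using 1 by auto
qed

lemma exists_large_primes:
  "\<exists>p :: nat \<Rightarrow> nat. inj p \<and> (\<forall>t. prime (p t) \<and> p t > N)"
proof -
  have "infinite ({p::nat. prime p} - {..N})"
    using primes_infinite by (rule Diff_infinite_finite[rotated]) simp
  then obtain p :: "nat \<Rightarrow> nat" where "inj p" "range p \<subseteq> {p. prime p} - {..N}"
    using infinite_countable_subset by blast
  then show ?thesis
    by (intro exI[of _ p]) (auto simp: image_subset_iff not_le)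
qed

lemma cayley_adj_irrefl:
  assumes "n > 1"
  shows "\<not> cayley_adj n x x"
proof -
  interpret residues "int n" "residue_ring (int n)"
    using assms by unfold_locales simp
  show ?thesis
    by (simp add: cayley_adj_def a_minus_def res_neg_eq res_add_eq res_units_eq mod_simps)
qed

lemma cayley_adj_sym:
  assumes "n > 0" "x \<in> cayley_verts n" "y \<in> cayley_verts n"
  shows "cayley_adj n x y \<longleftrightarrow> cayley_adj n y x"
  using cayley_adj_coprime[OF assms] cayley_adj_coprime[OF assms(1,3,2)]
    coprime_minus_left_iff[of "x - y" "int n"]
  by (cases "x = y") auto

text \<open>Nonadjacent vertices might agree in every colouring and so receive the same residue. For
  \<open>k > 4\<close> this is impossible, because distinct vertices of the cycle have different
  neighbourhoods; opposite vertices of a 4-cycle do not.\<close>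

lemma induced_cycle_of_colourings:
  fixes c :: "nat \<Rightarrow> nat \<Rightarrow> nat"
  assumes "k > 4" "r > 0" and le: "\<And>t i. t < r \<Longrightarrow> i < k \<Longrightarrow> c t i \<le> N"
    and c: "\<And>i j. i < j \<Longrightarrow> j < k \<Longrightarrow>
      (\<forall>t<r. c t i \<noteq> c t j) \<longleftrightarrow> j = Suc i \<or> i = 0 \<and> j = k - 1"
  shows "\<exists>n v. n > 0 \<and> card (prime_factors n) = r \<and>
    induced_cycle (cayley_verts n) (cayley_adj n) k v"
proof -
  \<comment> \<open>Since \<open>p t > N\<close>, different colours stay incongruent modulo
    \<open>p t\<close>.\<close>
  obtain p :: "nat \<Rightarrow> nat" where p: "inj p" "\<And>t. prime (p t)" "\<And>t. p t > N"
    using exists_large_primes by blast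
  define n where "n = (\<Prod>t<r. p t)"
  have "n > 0"
    using p(2) by (auto simp: n_def prime_gt_0_nat intro!: prod_pos)
  have dvd_n: "q dvd n \<longleftrightarrow> (\<exists>t<r. q = p t)" if "prime q" for q
  proof -
    have "q dvd n \<longleftrightarrow> (\<exists>t\<in>{..<r}. q dvd p t)"
      using that by (simp add: n_def prime_dvd_prod_iff)
    then show ?thesis
      using that p(2) by (metis dvd_refl lessThan_iff primes_dvd_imp_eq)
  qed
  then have pf: "prime_factors n = p ` {..<r}"
    using \<open>n > 0\<close> p(2) by (auto simp: prime_factors_dvd)
  have card: "card (prime_factors n) = r"
    using p(1) by (simp add: pf card_image inj_on_subset)
  have "n > 1"
  proof -
    have "p 0 dvd n" using dvd_n[OF p(2)] assms(2) by blast
    then show ?thesis using p(2)[of 0] \<open>n > 0\<close>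
      by (metis dvd_imp_le less_le_trans prime_gt_1_nat)
  qed
  have "\<exists>x<n. \<forall>t<r. [x = c t i] (mod p t)" for i
  proof -
    have "\<exists>!x. x < (\<Prod>t<r. p t) \<and> (\<forall>t\<in>{..<r}. [x = c t i] (mod p t))"
      using p by (intro chinese_remainder_unique_nat) (auto simp: primes_coprime prime_gt_0_nat inj_eq)
    then show ?thesis
      unfolding n_def by auto
  qed
  then obtain x where x: "\<And>i. x i < n" "\<And>i t. t < r \<Longrightarrow> [x i = c t i] (mod p t)"
    by metis
  define v where "v = (\<lambda>i. int (x i))"
  have verts: "v i \<in> cayley_verts n" for i
    using x(1) by (simp add: v_def cayley_verts_def residue_ring_def)
  have dvd_iff: "int (p t) dvd v i - v j \<longleftrightarrow> c t i = c t j" if "t < r" "i < k" "j < k" for t i j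
  proof -
    have "int (p t) dvd v i - v j \<longleftrightarrow> [x i = x j] (mod p t)"
      by (simp add: v_def cong_int_iff flip: cong_iff_dvd_diff)
    also have "\<dots> \<longleftrightarrow> [c t i = c t j] (mod p t)"
      using x(2)[OF that(1)] by (meson cong_sym cong_trans)
    also have "\<dots> \<longleftrightarrow> c t i = c t j"
      using le[OF that(1,2)] le[OF that(1,3)] p(3)[of t]
      by (metis cong_less_modulus_unique_nat cong_refl le_less_trans)
    finally show ?thesis .
  qed
  have coprime_iff: "coprime (v i - v j) (int n) \<longleftrightarrow> (\<forall>t<r. c t i \<noteq> c t j)"
    if "i < k" "j < k" for i j
  proof -
    have "coprime (v i - v j) (int n) \<longleftrightarrow> (\<forall>t<r. coprime (v i - v j) (int (p t)))"
    proof
      assume "coprime (v i - v j) (int n)"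
      moreover have "int (p t) dvd int n" if "t < r" for t
        using dvd_n[OF p(2)] that by auto
      ultimately show "\<forall>t<r. coprime (v i - v j) (int (p t))"
        by (meson coprime_divisors dvd_refl)
    next
      assume "\<forall>t<r. coprime (v i - v j) (int (p t))"
      then show "coprime (v i - v j) (int n)"
        unfolding n_def of_nat_prod by (intro prod_coprime_right) auto
    qed
    also have "\<dots> \<longleftrightarrow> (\<forall>t<r. \<not> int (p t) dvd v i - v j)"
    proof -
      have "coprime (v i - v j) (int (p t)) \<longleftrightarrow> \<not> int (p t) dvd v i - v j" for t
        using p(2)[of t] prime_imp_coprime[of "int (p t)" "v i - v j"]
        by (auto simp: coprime_commute dest: coprime_common_divisor)
      then show ?thesis by simp
    qed
    finally show ?thesis
      using dvd_iff that by auto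
  qed
  have neq: "v i \<noteq> v j" if ij: "i < j" "j < k" for i j
  proof
    assume eq: "v i = v j"
    then have same: "c t i = c t j" if "t < r" for t
      using dvd_iff[of t i j] ij that by simp
    then have "j \<noteq> Suc i"
      using c[of i j] ij assms(2) by blast
    \<comment> \<open>some neighbour of \<open>i\<close> is not a neighbour of \<open>j\<close>\<close>
    then consider "j > Suc (Suc i)" | "j = Suc (Suc i)" "i > 0" | "j = 2" "i = 0"
      using ij by linarith
    then show False
    proof cases
      case 1
      then show False
        using c[of i "Suc i"] c[of "Suc i" j] same ij by auto
    next
      case 2
      show False
      proof (cases "i = 1 \<and> j = k - 1")
        \<comment> \<open>Only here is the predecessor \<open>0\<close> of \<open>i\<close> also a
          neighbour of \<open>j\<close>; it would force \<open>k = 4\<close>.\<close>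
        case True
        then show False using 2 assms(1) by auto
      next
        case False
        obtain l where "i = Suc l"
          using 2(2) gr0_implies_Suc by blast
        then show False
          using False c[of l i] c[of l j] same ij 2 by auto
      qed
    next
      case 3
      then show False
        using c[of 0 "k - 1"] c[of 2 "k - 1"] same assms(1) ij by auto
    qed
  qed
  have adj: "cayley_adj n (v i) (v j) \<longleftrightarrow>
      [int i - int j = 1] (mod int k) \<or> [int i - int j = - 1] (mod int k)"
    if "i < j" "j < k" for i j
    unfolding cong_neighbour_iff[OF that] c[OF that, symmetric]
    using cayley_adj_coprime[OF \<open>n > 0\<close> verts verts neq[OF that]] coprime_iff[of i j] that
    by simp
  have "induced_cycle (cayley_verts n) (cayley_adj n) k v"
    unfolding induced_cycle_def
  proof (intro conjI allI impI)
    show "inj_on v {..<k}"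
      using neq by (intro linorder_inj_onI) auto
    show "v ` {..<k} \<subseteq> cayley_verts n"
      using verts by auto
  next
    fix i j assume ij: "i < k" "j < k"
    consider "i < j" | "i = j" | "j < i" by linarith
    then show "cayley_adj n (v i) (v j) \<longleftrightarrow>
      [int i - int j = 1] (mod int k) \<or> [int i - int j = - 1] (mod int k)"
    proof cases
      case 1
      then show ?thesis using adj ij by blast
    next
      case 2
      then show ?thesis
        using cayley_adj_irrefl[OF \<open>n > 1\<close>] assms(1)
        by (auto simp: cong_iff_dvd_diff)
    next
      case 3
      have "[int i - int j = 1] (mod int k) \<longleftrightarrow> [int j - int i = - 1] (mod int k)"
        "[int i - int j = - 1] (mod int k) \<longleftrightarrow> [int j - int i = 1] (mod int k)"
        using cong_minus_minus_iff[of "int j - int i" "- 1" "int k"]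
          cong_minus_minus_iff[of "int j - int i" 1 "int k"] by simp_all
      then show ?thesis
        using adj[OF 3 ij(1)] cayley_adj_sym[OF \<open>n > 0\<close> verts verts] by blast
    qed
  qed (use assms(1) in simp)
  then show ?thesis
    using card \<open>n > 0\<close> by blast
qed

section \<open>The lower bound for the maximum\<close>

text \<open>\<open>Sup\<close> and \<open>Max\<close> dominate their members here because cycle
  lengths are bounded for fixed \<open>r\<close>.\<close>

lemma max_longest_induced_cycle_ge:
  assumes "n > 0" "card (prime_factors n) = r"
    and v: "induced_cycle (cayley_verts n) (cayley_adj n) k v"
  shows "k \<le> max_longest_induced_cycle r"
proof -
  obtain N where N: "\<And>l v. induced_cycle (cayley_verts n) (cayley_adj n) l v \<Longrightarrow> l < N"
    using induced_cycle_length_bounded[of r] assms(1,2) by blast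
  have "k \<le> longest_induced_cycle n"
    unfolding longest_induced_cycle_def
  proof (rule cSup_upper)
    show "bdd_above {k. \<exists>v. induced_cycle (cayley_verts n) (cayley_adj n) k v}"
      using N by (intro bdd_aboveI[of _ N]) (auto intro: less_imp_le)
  qed (use v in blast)
  also have "\<dots> \<le> max_longest_induced_cycle r"
    unfolding max_longest_induced_cycle_def
    using assms(1,2) by (intro Max_ge finite_longest_induced_cycle) blast
  finally show ?thesis .
qed

theorem theorem3p1:
  fixes r :: nat
  assumes "r > 1"
  shows "max_longest_induced_cycle r \<ge> 2 ^ r + 2"
proof -
  \<comment> \<open>Secures \<open>k > 4\<close> for \<open>k = 2 ^ r + 2\<close>.\<close>
  have "(2::nat) ^ 2 \<le> 2 ^ r"
    using assms by (intro power_increasing) auto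
  then have "\<exists>n v. n > 0 \<and> card (prime_factors n) = r \<and>
      induced_cycle (cayley_verts n) (cayley_adj n) (2 ^ r + 2) v"
  proof (intro induced_cycle_of_colourings)
    show "cycle_colour r t i \<le> 2 ^ r + 4" if "i < 2 ^ r + 2" for t i
      using cycle_colour_le[of r t i] that by linarith
  next
    fix i j :: nat assume ij: "i < j" "j < 2 ^ r + 2"
    have "(2::nat) ^ r + 2 - 1 = 2 ^ r + 1"
      by simp
    then show "(\<forall>t<r. cycle_colour r t i \<noteq> cycle_colour r t j) \<longleftrightarrow>
        j = Suc i \<or> i = 0 \<and> j = 2 ^ r + 2 - 1"
      using cycle_colour_proper[OF ij] cycle_colours_agree[OF assms ij] by metis
  qed (use assms in auto)
  then show ?thesis
    using max_longest_induced_cycle_ge by blast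
qed

end
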